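(* Let $A\in\mathbb{R}^{m\times n}$, $b\in\mathbb{R}^m$, let $\mathcal{C}\subseteq\mathbb{R}^n$ be a non-empty closed set with orthogonal projection $P_{\mathcal C}$, and let $x^*$ be a fixed point of projected gradient descent (PGD) with step size $\eta>0$. Suppose that the following conditions hold. 1. $P_{\mathcal C}$ is Lipschitz-continuously differentiable both at $x^*$ and at $z^*_\eta = x^*-\eta A^\top(Ax^*-b)$, with derivatives $\nabla P_{\mathcal C}(x^* )$, $\nabla P_{\mathcal C}(z^*_\eta)$ and constants $c_1(x^* ),c_2(x^* )$ and $c_1(z^*_\eta),c_2(z^*_\eta)$, respectively. 2. The matrix $H=\nabla P_{\mathcal C}(z^*_\eta)\,(I_n-\eta A^\top A)\,\nabla P_{\mathcal C}(x^* )$ admits an eigendecomposition $H=Q\Lambda Q^{-1}$, where $Q\in\mathbb{R}^{n\times n}$ is invertible and $\Lambda$ is diagonal with all diagonal entries strictly less than $1$ in magnitude, i.e. $\rho(H)=\|\Lambda\|_2<1$. 3. The initial iterate $x^{(0)}\in\mathcal C$ satisfies $$\|x^{(0)}-x^*\|<\min\Bigl\{\frac{c_1(x^* )}{\kappa(Q)},\ \frac{c_1(z^*_\eta)}{\kappa(Q)\,u_\eta},\ \frac{1-\rho(H)}{q}\Bigr\},$$ where $u_\eta=\|I_n-\eta A^\top A\|_2$ and $q=\kappa^2(Q)\,u_\eta\bigl(c_2(z^*_\eta)\,u_\eta+\|\nabla P_{\mathcal C}(z^*_\eta)\|_2\,c_2(x^* )\bigr)$. Let $\{x^{(k)}\}_{k\ge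 0}$ be the sequence generated by PGD with step size $\eta$ from $x^{(0)}$. Then (for $\rho(H)>0$, so that the expressions below are defined), for any $0<\epsilon<1$, we have $\|x^{(k)}-x^*\|\le\epsilon\|x^{(0)}-x^*\|$ for all integers $$k\ \ge\ \frac{\log(1/\epsilon)+\log(\kappa(Q))}{\log(1/\rho(H))}+c_3,$$ where $c_3=c_3(\rho(H),\tau)>0$, with $\tau=\dfrac{q\,\|Q^{-1}(x^{(0)}-x^* )\|}{\|Q^{-1}\|_2\,(1-\rho(H))}$, is independent of $\epsilon$.
   Context: $\|\cdot\|$ is the Euclidean norm, $\|\cdot\|_2$ the spectral norm, $\rho(\cdot)$ the spectral radius, and $\kappa(Q)=\|Q\|_2\|Q^{-1}\|_2$ the condition number. A quotient with zero denominator or infinite numerator inside the minimum is read as $+\infty$. Projection: $d(x,\mathcal C)=\inf_{y\in\mathcal C}\|y-x\|$ and $\Pi_{\mathcal C}(x)=\{y\in\mathcal C:\|y-x\|=d(x,\mathcal C)\}$ (non-empty since $\mathcal C$ is closed and non-empty). $P_{\mathcal C}:\mathbb{R}^n\to\mathcal C$ is a fixed selection, $P_{\mathcal C}(x)\in\Pi_{\mathcal C}(x)$ for all $x$. Differentiability: let $x$ be such that $\Pi_{\mathcal C}(x)$ is a singleton. $P_{\mathcal C}$ is differentiable at $x$ if there is a matrix $\nabla P_{\mathcal C}(x)\in\mathbb{R}^{n\times n}$ with $$\limsup_{\delta\to0}\ \sup_{y\in\Pi_{\mathcal C}(x+\delta)}\frac{\|y-P_{\mathcal C}(x)-\nabla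 P_{\mathcal C}(x)\delta\|}{\|\delta\|}=0.$$ It is Lipschitz-continuously differentiable at $x$ with constants $c_1(x),c_2(x)$ if it is differentiable at $x$, $0<c_1(x)\le\infty$, $0\le c_2(x)<\infty$, and for all $\delta$ with $\|\delta\|<c_1(x)$, $$\sup_{y\in\Pi_{\mathcal C}(x+\delta)}\|y-P_{\mathcal C}(x)-\nabla P_{\mathcal C}(x)\delta\|\le c_2(x)\|\delta\|^2.$$ PGD (for $\min_{x\in\mathcal C}\frac12\|Ax-b\|^2$): starting from $x^{(0)}\in\mathcal C$, $x^{(k+1)}=P_{\mathcal C}\bigl(x^{(k)}-\eta A^\top(Ax^{(k)}-b)\bigr)$ for $k\ge0$. A point $x^*$ is a fixed point of PGD with step size $\eta>0$ if $x^*=P_{\mathcal C}\bigl(x^*-\eta A^\top(Ax^*-b)\bigr)$. The constant $c_3$: for $0<\rho<1$ and $0\le\tau<1$, $$c_3(\rho,\tau)=\frac{E_1\bigl(\log\frac{1}{\rho+\tau(1-\rho)}\bigr)-E_1\bigl(\log\frac1\rho\bigr)}{\rho\log(1/\rho)}+\frac{1}{2\rho}\log\Bigl(\frac{\log(1/\rho)}{\log\bigl(1/(\rho+\tau(1-\rho))\bigr)}\Bigr)+1,$$ where $E_1(t)=\int_t^\infty \frac{e^{-z}}{z}\,dz$. Terminology: in this situation PGD is said to converge locally to $x^*$ at asymptotic linear rate $\rho(H)$, with region of linear convergence given by the inequality in condition 3. *)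

theory Defs
  imports "HOL-Analysis.Analysis"
begin

definition spectral_norm :: "real^'n^'m \<Rightarrow> real" where
  "spectral_norm M = onorm ((*v) M)"

definition spectral_radius :: "real^'n^'n \<Rightarrow> real" where
  "spectral_radius M =
     Max (cmod ` {\<mu>. \<exists>v::complex^'n. v \<noteq> 0 \<and> map_matrix complex_of_real M *v v = \<mu> *s v})"

definition cond_number :: "real^'n^'n \<Rightarrow> real" where
  "cond_number Q = spectral_norm Q * spectral_norm (matrix_inv Q)"

definition proj_set :: "(real^'n) set \<Rightarrow> real^'n \<Rightarrow> (real^'n) set" where
  "proj_set C x = {y \<in> C. norm (y - x) = infdist x C}"

definition is_projection :: "(real^'n) set \<Rightarrow> (real^'n \<Rightarrow> real^'n) \<Rightarrow> bool" where
  "is_projection C P \<longleftrightarrow> (\<forall>x. P x \<in> proj_set C x)"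

text \<open>The suprema over \<^term>\<open>proj_set C (x + \<delta>)\<close> and the limes superior are taken in the
  extended reals, where they always exist.\<close>

definition has_proj_derivative ::
  "(real^'n) set \<Rightarrow> (real^'n \<Rightarrow> real^'n) \<Rightarrow> real^'n \<Rightarrow> real^'n^'n \<Rightarrow> bool" where
  "has_proj_derivative C P x D \<longleftrightarrow>
     is_singleton (proj_set C x) \<and>
     Limsup (at 0) (\<lambda>\<delta>. SUP y \<in> proj_set C (x + \<delta>).
        ereal (norm (y - P x - D *v \<delta>) / norm \<delta>)) = 0"

definition lipschitz_proj_derivative ::
  "(real^'n) set \<Rightarrow> (real^'n \<Rightarrow> real^'n) \<Rightarrow> real^'n \<Rightarrow> real^'n^'n \<Rightarrow> ereal \<Rightarrow> real \<Rightarrow> bool" where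
  "lipschitz_proj_derivative C P x D c1 c2 \<longleftrightarrow>
     has_proj_derivative C P x D \<and> 0 < c1 \<and> 0 \<le> c2 \<and>
     (\<forall>\<delta>. ereal (norm \<delta>) < c1 \<longrightarrow>
        (SUP y \<in> proj_set C (x + \<delta>). ereal (norm (y - P x - D *v \<delta>))) \<le> ereal (c2 * (norm \<delta>)\<^sup>2))"

definition gradient_step :: "real^'n^'m \<Rightarrow> real^'m \<Rightarrow> real \<Rightarrow> real^'n \<Rightarrow> real^'n" where
  "gradient_step A b \<eta> x = x - \<eta> *\<^sub>R (transpose A *v (A *v x - b))"

primrec pgd ::
  "(real^'n \<Rightarrow> real^'n) \<Rightarrow> real^'n^'m \<Rightarrow> real^'m \<Rightarrow> real \<Rightarrow> real^'n \<Rightarrow> nat \<Rightarrow> real^'n" where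
  "pgd P A b \<eta> x0 0 = x0"
| "pgd P A b \<eta> x0 (Suc k) = P (gradient_step A b \<eta> (pgd P A b \<eta> x0 k))"

definition pgd_fixed_point ::
  "(real^'n \<Rightarrow> real^'n) \<Rightarrow> real^'n^'m \<Rightarrow> real^'m \<Rightarrow> real \<Rightarrow> real^'n \<Rightarrow> bool" where
  "pgd_fixed_point P A b \<eta> x \<longleftrightarrow> x = P (gradient_step A b \<eta> x)"

text \<open>Only used for positive arguments.\<close>

definition E1 :: "real \<Rightarrow> real" where
  "E1 t = integral {t..} (\<lambda>z. exp (- z) / z)"

definition c3 :: "real \<Rightarrow> real \<Rightarrow> real" where
  "c3 \<rho> \<tau> =
     (E1 (ln (1 / (\<rho> + \<tau> * (1 - \<rho>)))) - E1 (ln (1 / \<rho>))) / (\<rho> * ln (1 / \<rho>))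
     + 1 / (2 * \<rho>) * ln (ln (1 / \<rho>) / ln (1 / (\<rho> + \<tau> * (1 - \<rho>)))) + 1"

text \<open>The bound on the distance of the initial iterate. The quotients are those of the extended
  reals; the numerators are positive in the intended use, and then a zero denominator or an
  infinite numerator makes the quotient infinite.\<close>

definition region_bound ::
  "ereal \<Rightarrow> ereal \<Rightarrow> real \<Rightarrow> real \<Rightarrow> real \<Rightarrow> real \<Rightarrow> ereal" where
  "region_bound c1x c1z \<kappa> u \<rho> q =
     min (c1x / ereal \<kappa>) (min (c1z / ereal (\<kappa> * u)) (ereal (1 - \<rho>) / ereal q))"

end

theory Submission
  imports Defs
begin

text \<open>
  Let \<open>\<bar>\<cdot>\<bar>\<close> be the Euclidean and the spectral norm. Write
  \<open>e\<^sub>k\<close> for the error of the \<open>k\<close>-th iterate and \<open>w\<^sub>k = Q\<^sup>-\<^sup>1 e\<^sub>k\<close>.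
  Iterates lie in \<open>C\<close>, so they are
  their own projections; the expansion of the projection at the limit therefore says that the
  error is almost fixed by \<open>Dx\<close>, while the expansion at the gradient step of the limit says that
  one iteration acts almost as \<open>Dz (I - \<eta> A\<^sup>T A)\<close>. Composing the two shows that one iteration acts as
  \<open>H\<close> up to a quadratic error (\<open>pgd_step_linearization\<close>). In the eigenbasis of \<open>H\<close> this reads
  \<open>\<bar>w\<^sub>k\<^sub>+\<^sub>1\<bar> \<le> \<rho> \<bar>w\<^sub>k\<bar> + (q / \<bar>Q\<^sup>-\<^sup>1\<bar>) \<bar>w\<^sub>k\<bar>\<^sup>2\<close> (\<open>diagonalized_step\<close>), where \<open>\<rho>\<close> is the
  largest modulus of a diagonal entry of \<open>\<Lambda>\<close> (\<open>spectral_radius_diagonalizable\<close>). The bound on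
  the initial error makes the right-hand side at most \<open>\<bar>w\<^sub>k\<bar>\<close>, so the iterates never
  leave the balls in which the expansions are valid, the factor \<open>\<kappa>\<close> in the region being the price
  of going to the eigenbasis and back.

  It remains to count the steps of the scalar recursion \<open>y \<mapsto> \<rho> y + \<sigma> y\<^sup>2\<close> from \<open>y = 1\<close>, with
  \<open>\<sigma> = \<tau> (1 - \<rho>)\<close>. For \<open>t = - ln y\<close> it is \<open>t \<mapsto> t + g t\<close> with
  \<open>g t = - ln (\<rho> + \<sigma> e\<^sup>-\<^sup>t)\<close>, which increases from \<open>ln (1 / (\<rho> + \<sigma>))\<close> to its limit
  \<open>L = ln (1 / \<rho>)\<close>. This is the Euler scheme with unit step for \<open>t' = g t\<close>, whose solution
  takes time \<open>\<integral> dt / g t\<close>. Substituting \<open>z = g t\<close> and using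
  \<open>e\<^sup>L\<^sup>-\<^sup>z - 1 \<ge> L - z\<close>, this time is at most \<open>t / L\<close> plus a difference of exponential integrals,
  the first term of \<open>c3\<close>. The Euler scheme is slower than the flow, by at most
  \<open>(1 / (2 \<rho>)) \<integral> g' / g\<close>; this is the second, logarithmic term of \<open>c3\<close>. Both
  corrections are contained in the function \<open>step_clock\<close>, which grows by at least one in every
  step (\<open>step_clock_advances\<close>). Summing over the steps gives \<open>log_orbit_lower_bound\<close>, which
  turns the condition on \<open>k\<close> into \<open>\<bar>w\<^sub>k\<bar> \<le> (\<epsilon> / \<kappa>) \<bar>w\<^sub>0\<bar>\<close>.
\<close>

section \<open>The exponential integral\<close>

lemma E1_integrand_integrable:
  fixes a :: real
  assumes "a > 0"
  shows "(\<lambda>z. exp (- z) / z) integrable_on {a..}"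
proof (rule measurable_bounded_by_integrable_imp_integrable)
  show "(\<lambda>z. exp (- z) / z) \<in> borel_measurable (lebesgue_on {a..})"
    using assms
    by (intro continuous_imp_measurable_on_sets_lebesgue continuous_intros) auto
  show "(\<lambda>z. (1 / a) * exp (- 1 * z)) integrable_on {a..}"
    using integrable_cmul[OF integrable_on_exp_minus_to_infinity[of 1 a], of "1 / a"] by simp
  fix z assume "z \<in> {a..}"
  with assms have "1 / z \<le> 1 / a" "z > 0" by (auto intro: divide_left_mono)
  then show "norm (exp (- z) / z) \<le> (1 / a) * exp (- 1 * z)"
    using mult_right_mono[of "1 / z" "1 / a" "exp (- z)"] by simp
qed auto

lemma E1_split:
  fixes a t :: real
  assumes "0 < a" "a \<le> t"
  shows "E1 t = E1 a - integral {a..t} (\<lambda>z. exp (- z) / z)"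
proof -
  have "(\<lambda>z. exp (- z) / z) integrable_on {a..t}"
    using assms by (intro integrable_continuous_real continuous_intros) auto
  moreover have "(\<lambda>z. exp (- z) / z) integrable_on {t..}"
    using assms by (intro E1_integrand_integrable) simp
  moreover have "{a..t} \<inter> {t..} = {t}" "{a..t} \<union> {t..} = {a..}"
    using assms by auto
  ultimately show ?thesis
    using integral_Un[of "\<lambda>z. exp (- z) / z" "{a..t}" "{t..}"] by (simp add: E1_def)
qed

lemma E1_has_real_derivative:
  fixes t :: real
  assumes "t > 0"
  shows "(E1 has_real_derivative - (exp (- t) / t)) (at t)"
proof -
  let ?f = "\<lambda>z::real. exp (- z) / z"
  have "((\<lambda>x. integral {t/2..x} ?f) has_real_derivative ?f t) (at t within {t/2..2*t})"
    using assms by (intro integral_has_real_derivative continuous_intros) auto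
  moreover have "at t within {t/2..2*t} = at t"
    using assms by (intro at_within_interior) auto
  ultimately have "((\<lambda>x. integral {t/2..x} ?f) has_real_derivative ?f t) (at t)"
    by simp
  then have "((\<lambda>x. E1 (t/2) - integral {t/2..x} ?f) has_real_derivative - ?f t) (at t)"
    by (auto intro!: derivative_eq_intros)
  then show ?thesis
  proof (rule DERIV_cong_ev[THEN iffD1, OF refl _ refl, rotated])
    have "\<forall>\<^sub>F x in nhds t. x > t/2"
      using eventually_nhds_in_open[of "{t/2<..}" t] assms by simp
    then show "\<forall>\<^sub>F x in nhds t. E1 (t/2) - integral {t/2..x} ?f = E1 x"
      by (rule eventually_mono) (rule E1_split[symmetric], use assms in auto)
  qed
qed

lemma E1_antimono:
  fixes a t :: real
  assumes "0 < a" "a \<le> t"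
  shows "E1 t \<le> E1 a"
proof -
  have "integral {a..t} (\<lambda>z. exp (- z) / z) \<ge> 0"
    using assms by (intro integral_nonneg integrable_continuous_real continuous_intros) auto
  with E1_split[OF assms] show ?thesis by simp
qed

section \<open>The scalar recursion on a logarithmic scale\<close>

text \<open>The decrement of \<open>ln y\<close> in one step of \<open>y \<mapsto> \<rho> y + \<sigma> y\<^sup>2\<close> at \<open>y = exp (- t)\<close>. On this scale
  the recursion is a translation whose length tends to \<open>ln (1 / \<rho>)\<close>, the asymptotic linear rate.\<close>

definition log_rate :: "real \<Rightarrow> real \<Rightarrow> real \<Rightarrow> real" where
  "log_rate \<rho> \<sigma> t = - ln (\<rho> + \<sigma> * exp (- t))"

definition log_orbit :: "real \<Rightarrow> real \<Rightarrow> nat \<Rightarrow> real" where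
  "log_orbit \<rho> \<sigma> k = ((\<lambda>t. t + log_rate \<rho> \<sigma> t) ^^ k) 0"

lemma log_orbit_0: "log_orbit \<rho> \<sigma> 0 = 0"
  by (simp add: log_orbit_def)

lemma log_orbit_Suc:
  "log_orbit \<rho> \<sigma> (Suc k) = log_orbit \<rho> \<sigma> k + log_rate \<rho> \<sigma> (log_orbit \<rho> \<sigma> k)"
  by (simp add: log_orbit_def)

text \<open>An upper estimate, up to an additive constant, of the number of steps that bring the orbit to
  \<open>t\<close>. The derivative of the first two terms is at least the reciprocal of \<open>log_rate\<close>, so their increments
  bound the travel time of the continuous flow; the third one pays for the rate being frozen during each step.\<close>

definition step_clock :: "real \<Rightarrow> real \<Rightarrow> real \<Rightarrow> real" where
  "step_clock \<rho> \<sigma> t = t / ln (1 / \<rho>) - E1 (log_rate \<rho> \<sigma> t) / (\<rho> * ln (1 / \<rho>))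
     + ln (log_rate \<rho> \<sigma> t) / (2 * \<rho>)"

lemma log_rate_bounds:
  fixes \<rho> \<sigma> t :: real
  assumes "0 < \<rho>" "0 \<le> \<sigma>" "\<rho> + \<sigma> < 1" "0 \<le> t"
  shows "0 < log_rate \<rho> \<sigma> t" "log_rate \<rho> \<sigma> t \<le> ln (1 / \<rho>)"
    "exp (- log_rate \<rho> \<sigma> t) = \<rho> + \<sigma> * exp (- t)"
    "ln (1 / \<rho>) \<le> log_rate \<rho> \<sigma> t + \<sigma> * exp (- t) / \<rho>"
proof -
  let ?y = "\<sigma> * exp (- t)"
  have y: "0 \<le> ?y" "?y \<le> \<sigma>"
    using assms mult_left_mono[of "exp (- t)" 1 \<sigma>] by auto
  then have "\<rho> + ?y < 1"
    using assms by linarith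
  then show "0 < log_rate \<rho> \<sigma> t"
    using y assms by (simp add: log_rate_def add_pos_nonneg)
  show "log_rate \<rho> \<sigma> t \<le> ln (1 / \<rho>)"
    using assms y by (simp add: log_rate_def ln_div)
  show "exp (- log_rate \<rho> \<sigma> t) = \<rho> + ?y"
    using assms y by (simp add: log_rate_def)
  have "ln (1 + ?y / \<rho>) \<le> ?y / \<rho>"
    using assms y by (intro ln_add_one_self_le_self) simp
  moreover have "1 + ?y / \<rho> = (\<rho> + ?y) / \<rho>"
    using assms by (simp add: field_simps)
  ultimately show "ln (1 / \<rho>) \<le> log_rate \<rho> \<sigma> t + ?y / \<rho>"
    using assms y by (simp add: log_rate_def ln_div)
qed

lemma log_rate_has_real_derivative:
  fixes \<rho> \<sigma> t :: real
  assumes "0 < \<rho>" "0 \<le> \<sigma>"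
  shows "(log_rate \<rho> \<sigma> has_real_derivative
           \<sigma> * exp (- t) / (\<rho> + \<sigma> * exp (- t))) (at t)"
proof -
  have "0 < \<rho> + \<sigma> * exp (- t)"
    using assms by (simp add: add_pos_nonneg)
  then show ?thesis
    unfolding log_rate_def by (auto intro!: derivative_eq_intros)
qed

lemma saturation_mono:
  fixes \<rho> x y :: real
  assumes "0 < \<rho>" "0 \<le> x" "x \<le> y"
  shows "x / (\<rho> + x) \<le> y / (\<rho> + y)"
  using assms by (simp add: frac_le_eq divide_le_0_iff algebra_simps add_pos_nonneg)

lemma log_rate_mono:
  fixes \<rho> \<sigma> s t :: real
  assumes "0 < \<rho>" "0 \<le> \<sigma>" "t \<le> s"
  shows "log_rate \<rho> \<sigma> t \<le> log_rate \<rho> \<sigma> s"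
  using assms unfolding log_rate_def
  by (simp add: add_pos_nonneg mult_left_mono)

text \<open>In the derivative of the \<open>E1\<close> term the factor \<open>exp (- log_rate \<rho> \<sigma> t)\<close> is exactly the denominator of
  the derivative of \<open>log_rate\<close> and cancels it. This is why the exponential integral appears.\<close>

lemma step_clock_has_real_derivative:
  fixes \<rho> \<sigma> t :: real
  assumes "0 < \<rho>" "0 \<le> \<sigma>" "\<rho> + \<sigma> < 1" "0 \<le> t"
  shows "(step_clock \<rho> \<sigma> has_real_derivative
           1 / ln (1 / \<rho>) + \<sigma> * exp (- t) / (\<rho> * ln (1 / \<rho>) * log_rate \<rho> \<sigma> t)
           + (\<sigma> * exp (- t) / (\<rho> + \<sigma> * exp (- t))) / log_rate \<rho> \<sigma> t / (2 * \<rho>)) (at t)"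
proof -
  note b = log_rate_bounds[OF assms]
  have pos: "0 < \<rho> + \<sigma> * exp (- t)" "0 < ln (1 / \<rho>)"
    using assms b by (auto simp: add_pos_nonneg)
  note D = log_rate_has_real_derivative[OF assms(1,2), of t]
  have E: "((\<lambda>s. E1 (log_rate \<rho> \<sigma> s)) has_real_derivative
      - (exp (- log_rate \<rho> \<sigma> t) / log_rate \<rho> \<sigma> t) * (\<sigma> * exp (- t) / (\<rho> + \<sigma> * exp (- t)))) (at t)"
    by (rule DERIV_chain2[OF E1_has_real_derivative[OF b(1)] D])
  have "- (exp (- log_rate \<rho> \<sigma> t) / log_rate \<rho> \<sigma> t) * (\<sigma> * exp (- t) / (\<rho> + \<sigma> * exp (- t)))
      = - (\<sigma> * exp (- t) / log_rate \<rho> \<sigma> t)"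
    using pos by (simp add: b(3))
  with E have E': "((\<lambda>s. E1 (log_rate \<rho> \<sigma> s)) has_real_derivative
      - (\<sigma> * exp (- t) / log_rate \<rho> \<sigma> t)) (at t)"
    by simp
  have N: "((\<lambda>s. ln (log_rate \<rho> \<sigma> s)) has_real_derivative
      (1 / log_rate \<rho> \<sigma> t) * (\<sigma> * exp (- t) / (\<rho> + \<sigma> * exp (- t)))) (at t)"
    by (rule DERIV_chain2[OF _ D]) (use b(1) in \<open>auto intro!: derivative_eq_intros\<close>)
  have "((\<lambda>s. s / ln (1 / \<rho>) - E1 (log_rate \<rho> \<sigma> s) / (\<rho> * ln (1 / \<rho>))
     + ln (log_rate \<rho> \<sigma> s) / (2 * \<rho>)) has_real_derivative
      (1 / ln (1 / \<rho>) - (- (\<sigma> * exp (- t) / log_rate \<rho> \<sigma> t)) / (\<rho> * ln (1 / \<rho>))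
       + ((1 / log_rate \<rho> \<sigma> t) * (\<sigma> * exp (- t) / (\<rho> + \<sigma> * exp (- t)))) / (2 * \<rho>))) (at t)"
    by (intro DERIV_add DERIV_diff DERIV_cdivide E' N DERIV_ident)
  then show ?thesis
    unfolding step_clock_def by (simp add: mult.assoc mult.left_commute mult.commute)
qed

text \<open>Let \<open>g\<close> be \<open>log_rate\<close>, \<open>h = g t\<close> and \<open>r = g' / g\<close>. The derivative of the clock at \<open>s\<close> is at least
  \<open>1 / g s + r s / (2 \<rho>)\<close>. Since the slope of \<open>g\<close> keeps at least the fraction \<open>\<rho>\<close> of its value during
  the step, \<open>1 / g s\<close> falls short of \<open>1 / h\<close> by at most \<open>(r s / \<rho>) (s - t) / h\<close>. So the derivative is
  at least \<open>1 / h + (r s / \<rho>) (1 / 2 - (s - t) / h)\<close>, and the weight in the last bracket has mean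
  zero over the step. As \<open>r\<close> is decreasing and the weight changes sign from plus to minus at the
  midpoint, \<open>r s\<close> may be replaced by its value there (Chebyshev's argument), which leaves a
  function whose integral over the step is one.\<close>

lemma step_clock_advances:
  fixes \<rho> \<sigma> t :: real
  assumes "0 < \<rho>" "0 \<le> \<sigma>" "\<rho> + \<sigma> < 1" "0 \<le> t"
  shows "step_clock \<rho> \<sigma> t + 1 \<le> step_clock \<rho> \<sigma> (t + log_rate \<rho> \<sigma> t)"
proof -
  define L where "L = ln (1 / \<rho>)"
  define g where "g = log_rate \<rho> \<sigma>"
  define g' where "g' s = \<sigma> * exp (- s) / (\<rho> + \<sigma> * exp (- s))" for s
  define r where "r s = g' s / g s" for s
  define h where "h = g t"
  define m where "m = t + h / 2"
  define R where "R = r m"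
  have hpos: "0 < h"
    using log_rate_bounds[OF assms] by (simp add: h_def g_def)
  have Lpos: "0 < L"
    using log_rate_bounds[OF assms] by (simp add: L_def)
  have gpos: "0 < g s" if "t \<le> s" for s
    using log_rate_bounds(1)[of \<rho> \<sigma> s] assms that by (simp add: g_def)
  have g'nn: "0 \<le> g' s" for s
    using assms by (simp add: g'_def add_pos_nonneg)
  have g'anti: "g' s \<le> g' x" if "x \<le> s" for x s
    unfolding g'_def using assms that by (intro saturation_mono mult_left_mono) auto
  have ranti: "r s \<le> r x" if "t \<le> x" "x \<le> s" for x s
    unfolding r_def
    using that g'anti[of x s] g'nn gpos log_rate_mono[OF assms(1,2), of x s]
    by (intro frac_le) (auto simp: g_def)
  \<comment> \<open>Within one step \<open>exp (- s)\<close> keeps at least the fraction \<open>exp (- h) \<ge> \<rho>\<close> of its value, hence so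
    does the slope.\<close>
  have slope: "\<rho> * g' x \<le> g' s" if "t \<le> x" "x \<le> s" "s \<le> t + h" for x s
  proof -
    have "\<rho> \<le> exp (- h)"
      using log_rate_bounds(3)[OF assms] assms by (simp add: h_def g_def)
    also have "\<dots> \<le> exp (x - s)"
      using that by simp
    finally have "\<rho> * exp (- x) \<le> exp (x - s) * exp (- x)"
      by (rule mult_right_mono) simp
    also have "\<dots> = exp (- s)"
      by (simp flip: exp_add)
    finally have "\<rho> * (\<sigma> * exp (- x)) \<le> \<sigma> * exp (- s)"
      using mult_left_mono[of "\<rho> * exp (- x)" "exp (- s)" \<sigma>] assms by (simp add: mult.left_commute)
    moreover have "\<sigma> * exp (- s) \<le> \<sigma> * exp (- x)"
      using assms that by (simp add: mult_left_mono)
    ultimately have "\<rho> * (\<sigma> * exp (- x)) / (\<rho> + \<sigma> * exp (- x)) \<le> \<sigma> * exp (- s) / (\<rho> + \<sigma> * exp (- s))"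
      using assms by (intro frac_le) (auto simp: add_pos_nonneg)
    then show ?thesis by (simp add: g'_def)
  qed
  have recip: "1 / h - r s / \<rho> * ((s - t) / h) \<le> 1 / g s" if s: "t \<le> s" "s \<le> t + h" for s
  proof -
    have "g s - h \<le> g' s / \<rho> * (s - t)"
    proof (cases "s = t")
      case True
      then show ?thesis by (simp add: h_def)
    next
      case False
      then have "t < s" using s by simp
      then obtain x where x: "t < x" "x < s" "g s - g t = (s - t) * g' x"
        using MVT2[of t s g g'] log_rate_has_real_derivative[OF assms(1,2)]
        by (auto simp: g_def g'_def)
      have "g' x \<le> g' s / \<rho>"
        using slope[of x s] x s assms by (simp add: field_simps)
      then have "(s - t) * g' x \<le> (s - t) * (g' s / \<rho>)"
        using s by (intro mult_left_mono) auto
      then show ?thesis using x by (simp add: h_def mult.commute)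
    qed
    then have "(g s - h) / (h * g s) \<le> (g' s / \<rho> * (s - t)) / (h * g s)"
      using hpos gpos[OF s(1)] by (intro divide_right_mono) auto
    moreover have "(g s - h) / (h * g s) = 1 / h - 1 / g s"
      using hpos gpos[OF s(1)] by (simp add: field_simps)
    moreover have "(g' s / \<rho> * (s - t)) / (h * g s) = r s / \<rho> * ((s - t) / h)"
      by (simp add: r_def)
    ultimately show ?thesis by linarith
  qed
  \<comment> \<open>The clock minus an antiderivative of \<open>1 / h + (R / \<rho>) (1 / 2 - (s - t) / h)\<close>.\<close>
  define F where
    "F s = step_clock \<rho> \<sigma> s - (s / h + R / \<rho> * (s / 2 - (s - t)\<^sup>2 / (2 * h)))" for s
  have "F t \<le> F (t + h)"
  proof (rule DERIV_nonneg_imp_nondecreasing[where f = F and a = t and b = "t + h"])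
    show "t \<le> t + h" using hpos by simp
    fix s assume s: "t \<le> s" "s \<le> t + h"
    then have s0: "0 \<le> s" using assms by simp
    let ?y = "\<sigma> * exp (- s)"
    let ?D = "1 / L + ?y / (\<rho> * L * g s) + r s / (2 * \<rho>)"
    have "(step_clock \<rho> \<sigma> has_real_derivative ?D) (at s)"
      using step_clock_has_real_derivative[OF assms(1-3) s0]
      by (simp add: L_def g_def r_def g'_def)
    moreover have "((\<lambda>s. s / h + R / \<rho> * (s / 2 - (s - t)\<^sup>2 / (2 * h))) has_real_derivative
        1 / h + R / \<rho> * (1 / 2 - (2 * (s - t)) / (2 * h))) (at s)"
      by (intro DERIV_add DERIV_cmult DERIV_diff DERIV_cdivide DERIV_ident)
        (auto intro!: derivative_eq_intros)
    ultimately have "(F has_real_derivative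
        ?D - (1 / h + R / \<rho> * (1 / 2 - (2 * (s - t)) / (2 * h)))) (at s)"
      unfolding F_def by (rule DERIV_diff)
    then have D: "(F has_real_derivative ?D - (1 / h + R / \<rho> * (1 / 2 - (s - t) / h))) (at s)"
      by (simp del: right_diff_distrib_numeral)
    \<comment> \<open>The excess of \<open>L\<close> over \<open>g s\<close> is at most \<open>?y / \<rho>\<close>, which the \<open>E1\<close> term supplies.\<close>
    have "1 / g s = (L / g s) / L"
      using Lpos by simp
    also have "\<dots> \<le> ((g s + ?y / \<rho>) / g s) / L"
      using log_rate_bounds(4)[OF assms(1-3) s0] gpos[OF s(1)] Lpos
      by (intro divide_right_mono) (auto simp: L_def g_def)
    also have "\<dots> = 1 / L + ?y / (\<rho> * L * g s)"
      using Lpos gpos[OF s(1)] assms by (simp add: field_simps)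
    finally have "1 / g s + r s / (2 * \<rho>) \<le> ?D" by simp
    with recip[OF s] have "1 / h - r s / \<rho> * ((s - t) / h) + r s / (2 * \<rho>) \<le> ?D"
      by linarith
    moreover have "1 / h - r s / \<rho> * ((s - t) / h) + r s / (2 * \<rho>)
        = 1 / h + r s / \<rho> * (1 / 2 - (s - t) / h)"
      by (simp add: algebra_simps)
    moreover have "R / \<rho> * (1 / 2 - (s - t) / h) \<le> r s / \<rho> * (1 / 2 - (s - t) / h)"
    proof (cases "s \<le> m")
      case True
      then have "R \<le> r s" "0 \<le> 1 / 2 - (s - t) / h"
        using ranti[of s m] s hpos by (auto simp: R_def m_def field_simps)
      then show ?thesis using assms by (intro mult_right_mono divide_right_mono) auto
    next
      case False
      then have "r s \<le> R" "1 / 2 - (s - t) / h \<le> 0"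
        using ranti[of m s] s hpos by (auto simp: R_def m_def field_simps)
      then show ?thesis using assms by (intro mult_right_mono_neg divide_right_mono) auto
    qed
    ultimately have "0 \<le> ?D - (1 / h + R / \<rho> * (1 / 2 - (s - t) / h))"
      by linarith
    with D show "\<exists>y. (F has_real_derivative y) (at s) \<and> 0 \<le> y" by blast
  qed
  moreover have "F (t + h) = step_clock \<rho> \<sigma> (t + h) - ((t + h) / h + R / \<rho> * (t / 2))"
    using hpos by (simp add: F_def power2_eq_square add_divide_distrib)
  moreover have "(t + h) / h = t / h + 1"
    using hpos by (simp add: field_simps)
  ultimately show ?thesis
    by (simp add: F_def h_def g_def)
qed

lemma log_orbit_nonneg:
  fixes \<rho> \<sigma> :: real
  assumes "0 < \<rho>" "0 \<le> \<sigma>" "\<rho> + \<sigma> < 1"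
  shows "0 \<le> log_orbit \<rho> \<sigma> k"
proof (induction k)
  case (Suc k)
  then show ?case
    using log_rate_bounds(1)[OF assms, of "log_orbit \<rho> \<sigma> k"] by (simp add: log_orbit_Suc)
qed (simp add: log_orbit_0)

lemma step_clock_orbit:
  fixes \<rho> \<sigma> :: real
  assumes "0 < \<rho>" "0 \<le> \<sigma>" "\<rho> + \<sigma> < 1"
  shows "real k \<le> step_clock \<rho> \<sigma> (log_orbit \<rho> \<sigma> k) - step_clock \<rho> \<sigma> 0"
proof (induction k)
  case (Suc k)
  then show ?case
    using step_clock_advances[OF assms log_orbit_nonneg[OF assms, of k]]
    by (simp add: log_orbit_Suc)
qed (simp add: log_orbit_0)

lemma segment_to_one_less_one:
  fixes \<rho> \<tau> :: real
  assumes "\<rho> < 1" "\<tau> < 1"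
  shows "\<rho> + \<tau> * (1 - \<rho>) < 1"
proof -
  have "0 < (1 - \<tau>) * (1 - \<rho>)"
    using assms by (intro mult_pos_pos) auto
  then show ?thesis by (simp add: algebra_simps)
qed

text \<open>Apart from its linear term, the clock depends on the ends of the orbit through the rates
  there. The initial rate is \<open>ln (1 / (\<rho> + \<sigma>))\<close>, and the final one is bounded by its limit \<open>ln (1 / \<rho>)\<close>; these are the
  arguments of \<open>E1\<close> and of the logarithm in \<open>c3\<close>.\<close>

lemma log_orbit_lower_bound:
  fixes \<rho> \<tau> :: real
  assumes "0 < \<rho>" "\<rho> < 1" "0 \<le> \<tau>" "\<tau> < 1"
  defines "\<sigma> \<equiv> \<tau> * (1 - \<rho>)"
  shows "real k \<le> log_orbit \<rho> \<sigma> k / ln (1 / \<rho>) + c3 \<rho> \<tau>"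
proof -
  have \<sigma>: "0 \<le> \<sigma>" "\<rho> + \<sigma> < 1"
    using assms segment_to_one_less_one[of \<rho> \<tau>] by (auto simp: \<sigma>_def)
  define L where "L = ln (1 / \<rho>)"
  define t where "t = log_orbit \<rho> \<sigma> k"
  define g where "g = log_rate \<rho> \<sigma>"
  have t0: "0 \<le> t" unfolding t_def by (rule log_orbit_nonneg[OF assms(1) \<sigma>])
  have g: "0 < g t" "g t \<le> L" "0 < g 0"
    using log_rate_bounds[OF assms(1) \<sigma> t0] log_rate_bounds[OF assms(1) \<sigma>, of 0]
    by (auto simp: g_def L_def)
  then have L: "0 < L" by simp
  have g0: "g 0 = ln (1 / (\<rho> + \<tau> * (1 - \<rho>)))"
    using assms \<sigma> by (simp add: g_def log_rate_def ln_div \<sigma>_def)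
  have "- E1 (g t) / (\<rho> * L) \<le> - E1 L / (\<rho> * L)"
    using E1_antimono[OF g(1,2)] L assms by (intro divide_right_mono) auto
  moreover have "ln (g t) / (2 * \<rho>) \<le> ln L / (2 * \<rho>)"
    using g L assms by (intro divide_right_mono) auto
  moreover have "real k \<le> step_clock \<rho> \<sigma> t - step_clock \<rho> \<sigma> 0"
    unfolding t_def by (rule step_clock_orbit[OF assms(1) \<sigma>])
  moreover have "c3 \<rho> \<tau> = (E1 (g 0) - E1 L) / (\<rho> * L) + (ln L - ln (g 0)) / (2 * \<rho>) + 1"
    unfolding c3_def g0[symmetric] L_def[symmetric] using L g by (simp add: ln_div)
  ultimately show ?thesis
    unfolding step_clock_def g_def[symmetric] L_def[symmetric] t_def[symmetric]
    by (simp add: diff_divide_distrib)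
qed

lemma c3_pos:
  fixes \<rho> \<tau> :: real
  assumes "0 < \<rho>" "\<rho> < 1" "0 \<le> \<tau>" "\<tau> < 1"
  shows "0 < c3 \<rho> \<tau>"
proof -
  define l where "l = ln (1 / (\<rho> + \<tau> * (1 - \<rho>)))"
  define L where "L = ln (1 / \<rho>)"
  have s: "\<rho> \<le> \<rho> + \<tau> * (1 - \<rho>)" "\<rho> + \<tau> * (1 - \<rho>) < 1"
    using assms segment_to_one_less_one[of \<rho> \<tau>] by auto
  have l: "0 < l" "l \<le> L"
    using assms s by (auto simp: l_def L_def ln_div)
  then have "0 \<le> (E1 l - E1 L) / (\<rho> * L)" "0 \<le> 1 / (2 * \<rho>) * ln (L / l)"
    using E1_antimono[of l L] assms by auto
  then show ?thesis unfolding c3_def l_def[symmetric] L_def[symmetric] by linarith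
qed

section \<open>Matrix norms and diagonalizable matrices\<close>

lemma norm_matrix_vector_le:
  fixes M :: "real^'n^'m"
  shows "norm (M *v x) \<le> spectral_norm M * norm x"
  unfolding spectral_norm_def by (rule onorm[OF matrix_vector_mul_bounded_linear])

lemma spectral_norm_nonneg:
  fixes M :: "real^'n^'m"
  shows "0 \<le> spectral_norm M"
  unfolding spectral_norm_def by (rule onorm_pos_le[OF matrix_vector_mul_bounded_linear])

lemma matrix_inv_cancel:
  fixes Q :: "real^'n^'n"
  assumes "invertible Q"
  shows "Q ** matrix_inv Q = mat 1" "matrix_inv Q ** Q = mat 1"
  using assms someI_ex[of "\<lambda>A'. Q ** A' = mat 1 \<and> A' ** Q = mat 1"]
  unfolding invertible_def matrix_inv_def by blast+

lemma cond_number_ge_1: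
  fixes Q :: "real^'n^'n"
  assumes "invertible Q"
  shows "1 \<le> cond_number Q"
proof -
  obtain x :: "real^'n" where x: "norm x = 1"
    using vector_choose_size[of 1] by auto
  have "1 = norm (Q *v (matrix_inv Q *v x))"
    using x by (simp add: matrix_vector_mul_assoc matrix_inv_cancel[OF assms])
  also have "\<dots> \<le> spectral_norm Q * norm (matrix_inv Q *v x)"
    by (rule norm_matrix_vector_le)
  also have "\<dots> \<le> spectral_norm Q * (spectral_norm (matrix_inv Q) * norm x)"
    by (intro mult_left_mono norm_matrix_vector_le spectral_norm_nonneg)
  finally show ?thesis using x by (simp add: cond_number_def)
qed

lemma map_matrix_of_real_mult:
  fixes M N :: "real^'n^'n"
  shows "map_matrix complex_of_real (M ** N)
         = map_matrix complex_of_real M ** map_matrix complex_of_real N"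
  by (simp add: vec_eq_iff matrix_matrix_mult_def)

lemma map_matrix_of_real_1:
  "map_matrix complex_of_real (mat 1 :: real^'n^'n) = mat 1"
  by (simp add: vec_eq_iff mat_def)

lemma diagonal_matrix_vector:
  fixes \<Lambda> :: "'a::comm_semiring_1^'n^'n"
  assumes "\<And>i j. i \<noteq> j \<Longrightarrow> \<Lambda> $ i $ j = 0"
  shows "(\<Lambda> *v x) $ i = \<Lambda> $ i $ i * x $ i"
proof -
  have "(\<Sum>j\<in>UNIV. \<Lambda> $ i $ j * x $ j) = (\<Sum>j\<in>UNIV. if j = i then \<Lambda> $ i $ i * x $ i else 0)"
    by (intro sum.cong) (auto simp: assms)
  then show ?thesis by (simp add: matrix_vector_mult_def)
qed

text \<open>The spectral radius refers to complex eigenvectors, so the real diagonalization is first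
  complexified; \<open>Q\<close> then carries the eigenpairs of \<open>\<Lambda>\<close> to those of the product and back.\<close>

lemma spectral_radius_diagonalizable:
  fixes Q \<Lambda> :: "real^'n^'n"
  assumes inv: "invertible Q" and diag: "\<And>i j. i \<noteq> j \<Longrightarrow> \<Lambda> $ i $ j = 0"
  shows "spectral_radius (Q ** \<Lambda> ** matrix_inv Q) = Max (range (\<lambda>i. \<bar>\<Lambda> $ i $ i\<bar>))"
proof -
  let ?c = "map_matrix complex_of_real :: real^'n^'n \<Rightarrow> complex^'n^'n"
  let ?H = "?c (Q ** \<Lambda> ** matrix_inv Q)"
  note cancel = matrix_inv_cancel[OF inv]
  have H: "?H = ?c Q ** ?c \<Lambda> ** ?c (matrix_inv Q)"
    by (simp add: map_matrix_of_real_mult)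
  have c1: "?c Q ** ?c (matrix_inv Q) = mat 1" and c2: "?c (matrix_inv Q) ** ?c Q = mat 1"
    by (simp_all add: cancel map_matrix_of_real_1 flip: map_matrix_of_real_mult)
  have cdiag: "?c \<Lambda> $ i $ j = 0" if "i \<noteq> j" for i j
    using diag[OF that] by simp
  have "{\<mu>. \<exists>v::complex^'n. v \<noteq> 0 \<and> ?H *v v = \<mu> *s v} = range (\<lambda>i. complex_of_real (\<Lambda> $ i $ i))"
  proof (intro equalityI subsetI)
    fix \<mu> assume "\<mu> \<in> {\<mu>. \<exists>v::complex^'n. v \<noteq> 0 \<and> ?H *v v = \<mu> *s v}"
    then obtain v where v: "v \<noteq> 0" "?H *v v = \<mu> *s v" by blast
    define w where "w = ?c (matrix_inv Q) *v v"
    have Qw: "?c Q *v w = v"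
      by (simp add: w_def matrix_vector_mul_assoc c1)
    then have "w \<noteq> 0" using v by auto
    then obtain i where i: "w $ i \<noteq> 0" by (auto simp: vec_eq_iff)
    have "?c \<Lambda> *v w = (?c (matrix_inv Q) ** ?c Q) *v (?c \<Lambda> *v w)"
      by (simp add: c2)
    also have "\<dots> = ?c (matrix_inv Q) *v (?H *v v)"
      by (simp add: H w_def matrix_vector_mul_assoc matrix_mul_assoc)
    also have "\<dots> = \<mu> *s w"
      by (simp add: v w_def vector_scalar_commute)
    finally have "(?c \<Lambda> *v w) $ i = (\<mu> *s w) $ i" by simp
    then have "complex_of_real (\<Lambda> $ i $ i) * w $ i = \<mu> * w $ i"
      using diagonal_matrix_vector[of "?c \<Lambda>", OF cdiag] by simp
    with i show "\<mu> \<in> range (\<lambda>i. complex_of_real (\<Lambda> $ i $ i))" by auto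
  next
    fix \<mu> assume "\<mu> \<in> range (\<lambda>i. complex_of_real (\<Lambda> $ i $ i))"
    then obtain i where \<mu>: "\<mu> = complex_of_real (\<Lambda> $ i $ i)" by blast
    define w :: "complex^'n" where "w = axis i 1"
    have "?c \<Lambda> *v w = \<mu> *s w"
      by (auto simp: vec_eq_iff diagonal_matrix_vector[of "?c \<Lambda>", OF cdiag] w_def \<mu> axis_def)
    then have "?H *v (?c Q *v w) = \<mu> *s (?c Q *v w)"
      by (simp add: H c2 vector_scalar_commute flip: matrix_vector_mul_assoc)
         (simp add: matrix_vector_mul_assoc c2 vector_scalar_commute)
    moreover have "?c Q *v w \<noteq> 0"
    proof
      assume "?c Q *v w = 0"
      then have "(?c (matrix_inv Q) ** ?c Q) *v w = 0"
        by (simp flip: matrix_vector_mul_assoc)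
      then show False by (simp add: c2 w_def axis_eq_0_iff)
    qed
    ultimately show "\<mu> \<in> {\<mu>. \<exists>v::complex^'n. v \<noteq> 0 \<and> ?H *v v = \<mu> *s v}" by blast
  qed
  then show ?thesis
    by (simp add: spectral_radius_def image_image)
qed

lemma norm_diagonal_matrix_vector_le:
  fixes \<Lambda> :: "real^'n^'n"
  assumes "\<And>i j. i \<noteq> j \<Longrightarrow> \<Lambda> $ i $ j = 0"
  shows "norm (\<Lambda> *v x) \<le> Max (range (\<lambda>i. \<bar>\<Lambda> $ i $ i\<bar>)) * norm x"
proof -
  let ?r = "Max (range (\<lambda>i. \<bar>\<Lambda> $ i $ i\<bar>))"
  have r: "\<bar>\<Lambda> $ i $ i\<bar> \<le> ?r" for i by (intro Max_ge) auto
  then have "0 \<le> ?r" by (meson abs_ge_zero order_trans)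
  have "norm (\<Lambda> *v x) \<le> norm (?r *\<^sub>R x)"
    using r \<open>0 \<le> ?r\<close>
    by (intro norm_le_componentwise_cart)
      (simp add: diagonal_matrix_vector[OF assms] abs_mult mult_right_mono)
  then show ?thesis using \<open>0 \<le> ?r\<close> by simp
qed

section \<open>One step of projected gradient descent\<close>

lemma proj_set_self:
  assumes "x \<in> C"
  shows "proj_set C x = {x}"
  using assms by (auto simp: proj_set_def)

lemma lipschitz_proj_derivativeD:
  assumes "lipschitz_proj_derivative C P x D c1 c2"
    and "y \<in> proj_set C (x + \<delta>)" and "ereal (norm \<delta>) < c1"
  shows "norm (y - P x - D *v \<delta>) \<le> c2 * (norm \<delta>)\<^sup>2"
proof -
  have "ereal (norm (y - P x - D *v \<delta>))
      \<le> (SUP y \<in> proj_set C (x + \<delta>). ereal (norm (y - P x - D *v \<delta>)))"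
    using assms(2) by (rule SUP_upper)
  also have "\<dots> \<le> ereal (c2 * (norm \<delta>)\<^sup>2)"
    using assms(1,3) by (simp add: lipschitz_proj_derivative_def)
  finally show ?thesis by simp
qed

lemma gradient_step_diff:
  "gradient_step A b \<eta> x
     = gradient_step A b \<eta> y + (mat 1 - \<eta> *\<^sub>R (transpose A ** A)) *v (x - y)"
proof -
  have "(mat 1 - \<eta> *\<^sub>R (transpose A ** A)) *v d = d - \<eta> *\<^sub>R (transpose A *v (A *v d))" for d
    by (simp add: matrix_vector_mult_diff_rdistrib matrix_vector_mul_assoc
        flip: scaleR_matrix_vector_assoc)
  then show ?thesis
    by (simp add: gradient_step_def matrix_vector_mult_diff_distrib algebra_simps)
qed

text \<open>Let \<open>e = x - xs\<close>. A point of \<open>C\<close> is its own projection, so the expansion at \<open>xs\<close> bounds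
  \<open>e - Dx e\<close> by \<open>c2x \<bar>e\<bar>\<^sup>2\<close>. This lets \<open>Dx\<close> be inserted in front of \<open>e\<close> in the expansion at the
  gradient step of \<open>xs\<close>, where the increment is \<open>G e\<close>, at the cost of a second quadratic term.\<close>

lemma pgd_step_linearization:
  fixes A :: "real^'n^'m" and C :: "(real^'n) set" and Dx Dz :: "real^'n^'n" and \<eta> :: real
  defines "G \<equiv> mat 1 - \<eta> *\<^sub>R (transpose A ** A)"
  assumes P: "is_projection C P" and fp: "pgd_fixed_point P A b \<eta> xs"
    and Lx: "lipschitz_proj_derivative C P xs Dx c1x c2x"
    and Lz: "lipschitz_proj_derivative C P (gradient_step A b \<eta> xs) Dz c1z c2z"
    and xC: "x \<in> C"
    and x1: "ereal (norm (x - xs)) < c1x"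
    and x2: "ereal (spectral_norm G * norm (x - xs)) < c1z"
  shows "norm (P (gradient_step A b \<eta> x) - xs - (Dz ** G ** Dx) *v (x - xs))
    \<le> spectral_norm G * (c2z * spectral_norm G + spectral_norm Dz * c2x) * (norm (x - xs))\<^sup>2"
proof -
  define e where "e = x - xs"
  let ?u = "spectral_norm G"
  have c2z: "0 \<le> c2z" using Lz by (simp add: lipschitz_proj_derivative_def)
  have xs: "xs = P (gradient_step A b \<eta> xs)"
    using fp by (simp add: pgd_fixed_point_def)
  have PC: "P y \<in> proj_set C y" for y
    using P by (simp add: is_projection_def)
  have "xs \<in> C"
    using PC[of "gradient_step A b \<eta> xs"] xs by (simp add: proj_set_def)
  then have Pxs: "P xs = xs"
    using PC[of xs] by (simp add: proj_set_self)
  have Ge: "norm (G *v e) \<le> ?u * norm e"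
    by (rule norm_matrix_vector_le)
  have "x \<in> proj_set C (xs + e)"
    using xC by (simp add: e_def proj_set_self)
  then have 1: "norm (e - Dx *v e) \<le> c2x * (norm e)\<^sup>2"
    using lipschitz_proj_derivativeD[OF Lx, of x e] x1 Pxs by (simp add: e_def)
  have "gradient_step A b \<eta> x = gradient_step A b \<eta> xs + G *v e"
    unfolding G_def e_def by (rule gradient_step_diff)
  moreover have "ereal (norm (G *v e)) < c1z"
    using Ge x2 by (intro le_less_trans[of "ereal (norm (G *v e))" "ereal (?u * norm e)"])
      (auto simp: e_def)
  ultimately have "norm (P (gradient_step A b \<eta> x) - xs - Dz *v (G *v e))
      \<le> c2z * (norm (G *v e))\<^sup>2"
    using lipschitz_proj_derivativeD[OF Lz] PC[of "gradient_step A b \<eta> x"] xs by metis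
  also have "\<dots> \<le> c2z * (?u * norm e)\<^sup>2"
    using Ge c2z by (intro mult_left_mono power_mono) auto
  finally have 2: "norm (P (gradient_step A b \<eta> x) - xs - Dz *v (G *v e)) \<le> c2z * (?u * norm e)\<^sup>2" .
  have "norm (Dz *v (G *v (e - Dx *v e))) \<le> spectral_norm Dz * norm (G *v (e - Dx *v e))"
    by (rule norm_matrix_vector_le)
  also have "\<dots> \<le> spectral_norm Dz * (?u * norm (e - Dx *v e))"
    by (intro mult_left_mono norm_matrix_vector_le spectral_norm_nonneg)
  also have "\<dots> \<le> spectral_norm Dz * (?u * (c2x * (norm e)\<^sup>2))"
    by (intro mult_left_mono 1 spectral_norm_nonneg)
  finally have 3: "norm (Dz *v (G *v (e - Dx *v e))) \<le> spectral_norm Dz * (?u * (c2x * (norm e)\<^sup>2))" .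
  have "P (gradient_step A b \<eta> x) - xs - (Dz ** G ** Dx) *v e
      = (P (gradient_step A b \<eta> x) - xs - Dz *v (G *v e)) + Dz *v (G *v (e - Dx *v e))"
    by (simp add: matrix_vector_mult_diff_distrib matrix_vector_mul_assoc matrix_mul_assoc)
  then have "norm (P (gradient_step A b \<eta> x) - xs - (Dz ** G ** Dx) *v e)
      \<le> c2z * (?u * norm e)\<^sup>2 + spectral_norm Dz * (?u * (c2x * (norm e)\<^sup>2))"
    using norm_triangle_mono[OF 2 3] by (simp only:)
  then show ?thesis
    by (simp add: e_def power2_eq_square algebra_simps)
qed

text \<open>The linear part acts diagonally on \<open>matrix_inv Q *v e\<close>. Passing to these coordinates and back
  multiplies the quadratic error by \<open>\<bar>Q\<^sup>-\<^sup>1\<bar> \<bar>Q\<bar>\<^sup>2 = \<kappa>\<^sup>2 / \<bar>Q\<^sup>-\<^sup>1\<bar>\<close>.\<close>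

lemma diagonalized_step:
  fixes Q \<Lambda> :: "real^'n^'n" and e e' :: "real^'n"
  assumes inv: "invertible Q" and diag: "\<And>i j. i \<noteq> j \<Longrightarrow> \<Lambda> $ i $ j = 0"
    and K: "0 \<le> K"
    and step: "norm (e' - (Q ** \<Lambda> ** matrix_inv Q) *v e) \<le> K * (norm e)\<^sup>2"
  shows "norm (matrix_inv Q *v e')
    \<le> Max (range (\<lambda>i. \<bar>\<Lambda> $ i $ i\<bar>)) * norm (matrix_inv Q *v e)
      + (cond_number Q)\<^sup>2 * K / spectral_norm (matrix_inv Q) * (norm (matrix_inv Q *v e))\<^sup>2"
proof -
  let ?R = "matrix_inv Q"
  let ?N = "spectral_norm ?R" and ?S = "spectral_norm Q"
  define w where "w = ?R *v e"
  note cancel = matrix_inv_cancel[OF inv]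
  have N: "0 < ?N"
    using cond_number_ge_1[OF inv] spectral_norm_nonneg[of ?R]
    by (cases "?N = 0") (auto simp: cond_number_def)
  have "?R *v ((Q ** \<Lambda> ** ?R) *v e) = (?R ** Q) *v (\<Lambda> *v w)"
    by (simp add: w_def matrix_vector_mul_assoc matrix_mul_assoc)
  then have split: "?R *v e' = \<Lambda> *v w + ?R *v (e' - (Q ** \<Lambda> ** ?R) *v e)"
    by (simp add: cancel matrix_vector_mult_diff_distrib)
  have "e = Q *v w"
    by (simp add: w_def matrix_vector_mul_assoc cancel)
  then have e: "norm e \<le> ?S * norm w"
    using norm_matrix_vector_le[of Q w] by simp
  have "norm (?R *v (e' - (Q ** \<Lambda> ** ?R) *v e)) \<le> ?N * norm (e' - (Q ** \<Lambda> ** ?R) *v e)"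
    by (rule norm_matrix_vector_le)
  also have "\<dots> \<le> ?N * (K * (norm e)\<^sup>2)"
    by (intro mult_left_mono step spectral_norm_nonneg)
  also have "\<dots> \<le> ?N * (K * (?S * norm w)\<^sup>2)"
    using e K by (intro mult_left_mono power_mono spectral_norm_nonneg) auto
  also have "\<dots> = (cond_number Q)\<^sup>2 * K / ?N * (norm w)\<^sup>2"
    using N by (simp add: cond_number_def power2_eq_square)
  finally show ?thesis
    unfolding split w_def[symmetric]
    by (intro norm_triangle_mono norm_diagonal_matrix_vector_le[OF diag])
qed

section \<open>Local linear convergence\<close>

text \<open>Clears the denominators of the region of convergence. A zero denominator makes the quotient
  infinite, and the conclusion is then \<open>0 < c\<close>.\<close>

lemma ereal_less_quotient_imp:
  fixes c :: ereal and k n :: real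
  assumes "0 \<le> k" "0 < c" "ereal n < c / ereal k"
  shows "ereal (k * n) < c"
proof (cases "k = 0")
  case False
  with assms have "ereal k * ereal n < c"
    by (subst ereal_less_divide_pos[symmetric]) auto
  then show ?thesis by simp
qed (use assms in \<open>simp flip: zero_ereal_def\<close>)

theorem theorem1:
  fixes A :: "real^'n^'m" and b :: "real^'m"
    and C :: "(real^'n) set" and P :: "real^'n \<Rightarrow> real^'n"
    and \<eta> :: real and xs zs x0 :: "real^'n"
    and Dx Dz H Q \<Lambda> :: "real^'n^'n"
    and c1x c1z :: ereal and c2x c2z u q \<tau> :: real
  assumes "C \<noteq> {}" and "closed C" and "is_projection C P"
    and "\<eta> > 0" and "pgd_fixed_point P A b \<eta> xs"
    and "zs = gradient_step A b \<eta> xs"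
    and "lipschitz_proj_derivative C P xs Dx c1x c2x"
    and "lipschitz_proj_derivative C P zs Dz c1z c2z"
    and "H = Dz ** (mat 1 - \<eta> *\<^sub>R (transpose A ** A)) ** Dx"
    and "invertible Q" and "H = Q ** \<Lambda> ** matrix_inv Q"
    and "\<And>i j. i \<noteq> j \<Longrightarrow> \<Lambda> $ i $ j = 0" and "\<And>i. \<bar>\<Lambda> $ i $ i\<bar> < 1"
    and "u = spectral_norm (mat 1 - \<eta> *\<^sub>R (transpose A ** A))"
    and "q = (cond_number Q)\<^sup>2 * u * (c2z * u + spectral_norm Dz * c2x)"
    and "x0 \<in> C"
    and "ereal (norm (x0 - xs)) < region_bound c1x c1z (cond_number Q) u (spectral_radius H) q"
    and "\<tau> = q * norm (matrix_inv Q *v (x0 - xs)) / (spectral_norm (matrix_inv Q) * (1 - spectral_radius H))"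
    and "spectral_radius H > 0"
  shows "c3 (spectral_radius H) \<tau> > 0 \<and>
    (\<forall>\<epsilon>::real. 0 < \<epsilon> \<and> \<epsilon> < 1 \<longrightarrow>
      (\<forall>k::nat. real k \<ge> (ln (1 / \<epsilon>) + ln (cond_number Q)) / ln (1 / spectral_radius H)
                        + c3 (spectral_radius H) \<tau> \<longrightarrow>
         norm (pgd P A b \<eta> x0 k - xs) \<le> \<epsilon> * norm (x0 - xs)))"
proof -
  define \<rho> where "\<rho> = spectral_radius H"
  define G where "G = mat 1 - \<eta> *\<^sub>R (transpose A ** A)"
  define R where "R = matrix_inv Q"
  define S where "S = spectral_norm Q"
  define N where "N = spectral_norm R"
  define \<kappa> where "\<kappa> = cond_number Q"
  define K where "K = u * (c2z * u + spectral_norm Dz * c2x)"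
  define n0 where "n0 = norm (x0 - xs)"
  define a0 where "a0 = norm (R *v (x0 - xs))"
  define x where "x = pgd P A b \<eta> x0"
  have inv: "invertible Q" and diag: "\<And>i j. i \<noteq> j \<Longrightarrow> \<Lambda> $ i $ j = 0"
    by fact+
  have Lz: "lipschitz_proj_derivative C P (gradient_step A b \<eta> xs) Dz c1z c2z"
    using assms by simp
  have c: "0 < c1x" "0 < c1z" "0 \<le> c2x" "0 \<le> c2z"
    using assms by (simp_all add: lipschitz_proj_derivative_def)
  have \<rho>_Max: "\<rho> = Max (range (\<lambda>i. \<bar>\<Lambda> $ i $ i\<bar>))"
    unfolding \<rho>_def \<open>H = Q ** \<Lambda> ** matrix_inv Q\<close>
    by (rule spectral_radius_diagonalizable[OF inv diag])
  have "Max (range (\<lambda>i. \<bar>\<Lambda> $ i $ i\<bar>)) < 1"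
    using \<open>\<And>i. \<bar>\<Lambda> $ i $ i\<bar> < 1\<close> by (subst Max_less_iff) auto
  then have \<rho>: "0 < \<rho>" "\<rho> < 1"
    using assms by (simp_all add: \<rho>_Max[symmetric] \<rho>_def)
  have u: "u = spectral_norm G" "0 \<le> u"
    using assms spectral_norm_nonneg[of G] by (simp_all add: G_def)
  have K: "0 \<le> K"
    unfolding K_def using u c by (intro mult_nonneg_nonneg add_nonneg_nonneg spectral_norm_nonneg)
  have q: "q = \<kappa>\<^sup>2 * K" "0 \<le> q"
    using assms K by (simp_all add: \<kappa>_def K_def mult.assoc)
  have \<kappa>: "1 \<le> \<kappa>" "\<kappa> = S * N"
    using cond_number_ge_1[OF inv] by (simp_all add: \<kappa>_def S_def N_def R_def cond_number_def)
  have SN: "0 \<le> S" "0 \<le> N"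
    by (simp_all add: S_def N_def spectral_norm_nonneg)
  then have N: "0 < N"
    using \<kappa> by (cases "N = 0") auto
  have a0: "0 \<le> a0" "a0 \<le> N * n0"
    unfolding a0_def n0_def N_def by (auto intro: norm_matrix_vector_le)
  have "ereal n0 < region_bound c1x c1z \<kappa> u \<rho> q"
    using assms by (simp add: n0_def \<kappa>_def \<rho>_def)
  then have "ereal n0 < c1x / ereal \<kappa>" "ereal n0 < c1z / ereal (\<kappa> * u)"
      "ereal n0 < ereal (1 - \<rho>) / ereal q"
    by (simp_all add: region_bound_def)
  then have n0: "ereal (\<kappa> * n0) < c1x" "ereal (\<kappa> * u * n0) < c1z" "q * n0 < 1 - \<rho>"
    using ereal_less_quotient_imp[of \<kappa> c1x n0] ereal_less_quotient_imp[of "\<kappa> * u" c1z n0]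
      ereal_less_quotient_imp[of q "ereal (1 - \<rho>)" n0] c \<kappa> u q \<rho>
    by (auto simp flip: zero_ereal_def)
  define \<sigma> where "\<sigma> = \<tau> * (1 - \<rho>)"
  have \<tau>_eq: "\<tau> = q * a0 / (N * (1 - \<rho>))"
    using assms by (simp add: a0_def N_def R_def \<rho>_def)
  then have \<sigma>_eq: "\<sigma> = q * a0 / N"
    using \<rho> by (simp add: \<sigma>_def)
  have "q * a0 \<le> N * (q * n0)"
    using mult_left_mono[OF a0(2) q(2)] by (simp add: mult.left_commute)
  also have "\<dots> < N * (1 - \<rho>)"
    using n0 N by simp
  finally have \<tau>: "0 \<le> \<tau>" "\<tau> < 1"
    using \<rho> N q a0 by (simp_all add: \<tau>_eq)
  have \<sigma>: "0 \<le> \<sigma>"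
    using \<tau> \<rho> by (simp add: \<sigma>_def)
  have \<rho>\<sigma>: "\<rho> + \<sigma> < 1"
    unfolding \<sigma>_def using \<rho>(2) \<tau>(2) by (rule segment_to_one_less_one)
  note nonneg = log_orbit_nonneg[OF \<rho>(1) \<sigma> \<rho>\<sigma>]
  have err: "norm e \<le> S * norm (R *v e)" for e
  proof -
    have "Q *v (R *v e) = e"
      by (simp add: R_def matrix_vector_mul_assoc matrix_inv_cancel[OF inv])
    then show ?thesis
      using norm_matrix_vector_le[of Q "R *v e"] by (simp add: S_def)
  qed
  \<comment> \<open>The bound itself keeps \<open>x k\<close> in the balls of the two expansions, which the next step needs.\<close>
  have main: "x k \<in> C \<and> norm (R *v (x k - xs)) \<le> a0 * exp (- log_orbit \<rho> \<sigma> k)" for k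
  proof (induction k)
    case 0
    show ?case
      using \<open>x0 \<in> C\<close> by (simp add: x_def a0_def log_orbit_0)
  next
    case (Suc k)
    define t where "t = log_orbit \<rho> \<sigma> k"
    define a where "a = norm (R *v (x k - xs))"
    have a: "a \<le> a0 * exp (- t)" "0 \<le> a"
      using Suc by (auto simp: a_def t_def)
    have t: "0 \<le> t"
      unfolding t_def by (rule nonneg)
    have "a0 * exp (- t) \<le> a0"
      using a0 t by (simp add: mult_left_le)
    then have "S * a \<le> S * (N * n0)"
      using a a0 SN by (intro mult_left_mono) auto
    then have ball: "norm (x k - xs) \<le> \<kappa> * n0"
      using err[of "x k - xs"] by (simp add: a_def \<kappa> mult.assoc)
    then have "ereal (norm (x k - xs)) < c1x"
      using n0(1) by (meson ereal_less_eq(3) le_less_trans)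
    moreover have "u * norm (x k - xs) \<le> \<kappa> * u * n0"
      using mult_left_mono[OF ball u(2)] by (simp add: mult_ac)
    then have "ereal (spectral_norm G * norm (x k - xs)) < c1z"
      using n0(2) u(1) by (metis ereal_less_eq(3) le_less_trans)
    ultimately have "norm (x (Suc k) - xs - H *v (x k - xs)) \<le> K * (norm (x k - xs))\<^sup>2"
      using pgd_step_linearization[OF \<open>is_projection C P\<close> \<open>pgd_fixed_point P A b \<eta> xs\<close>
        \<open>lipschitz_proj_derivative C P xs Dx c1x c2x\<close> Lz, of "x k"] Suc
      by (simp add: x_def K_def u(1) G_def \<open>H = Dz ** _ ** Dx\<close>)
    then have "norm (R *v (x (Suc k) - xs)) \<le> \<rho> * a + q / N * a\<^sup>2"
      using diagonalized_step[OF inv diag K, of "x (Suc k) - xs" "x k - xs"]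
      by (simp add: \<open>H = Q ** \<Lambda> ** matrix_inv Q\<close> \<rho>_Max a_def R_def N_def q \<kappa>_def)
    also have "\<dots> \<le> \<rho> * (a0 * exp (- t)) + q / N * (a0 * exp (- t))\<^sup>2"
      using a \<rho> q N by (intro add_mono mult_left_mono power_mono) auto
    also have "\<dots> = a0 * exp (- t) * (\<rho> + \<sigma> * exp (- t))"
      by (simp add: \<sigma>_eq power2_eq_square algebra_simps)
    also have "\<dots> = a0 * (exp (- t) * exp (- log_rate \<rho> \<sigma> t))"
      by (simp add: log_rate_bounds(3)[OF \<rho>(1) \<sigma> \<rho>\<sigma> t])
    also have "\<dots> = a0 * exp (- log_orbit \<rho> \<sigma> (Suc k))"
      by (simp add: log_orbit_Suc t_def flip: exp_add)
    finally have "norm (R *v (x (Suc k) - xs)) \<le> a0 * exp (- log_orbit \<rho> \<sigma> (Suc k))" .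
    moreover have "x (Suc k) \<in> C"
      using \<open>is_projection C P\<close> by (simp add: x_def is_projection_def proj_set_def)
    ultimately show ?case by simp
  qed
  have "norm (x k - xs) \<le> \<epsilon> * n0"
    if \<epsilon>: "0 < \<epsilon>" and k: "(ln (1 / \<epsilon>) + ln \<kappa>) / ln (1 / \<rho>) + c3 \<rho> \<tau> \<le> real k" for \<epsilon> k
  proof -
    define t where "t = log_orbit \<rho> \<sigma> k"
    have "real k \<le> t / ln (1 / \<rho>) + c3 \<rho> \<tau>"
      unfolding t_def \<sigma>_def by (rule log_orbit_lower_bound[OF \<rho> \<tau>])
    with k have "(ln (1 / \<epsilon>) + ln \<kappa>) / ln (1 / \<rho>) \<le> t / ln (1 / \<rho>)" by linarith
    then have "ln (1 / \<epsilon>) + ln \<kappa> \<le> t"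
      using \<rho> by (simp add: divide_le_cancel)
    then have "exp (- t) \<le> exp (ln \<epsilon> - ln \<kappa>)"
      using \<epsilon> by (simp add: ln_div)
    then have t: "exp (- t) \<le> \<epsilon> / \<kappa>"
      using \<epsilon> \<kappa>(1) by (simp add: exp_diff)
    have "norm (x k - xs) \<le> S * norm (R *v (x k - xs))"
      by (rule err)
    also have "\<dots> \<le> S * (N * n0 * (\<epsilon> / \<kappa>))"
      using main[of k] a0 SN t
      by (intro mult_left_mono order_trans[OF conjunct2[OF main] mult_mono]) (auto simp: t_def)
    also have "\<dots> = \<kappa> * n0 * (\<epsilon> / \<kappa>)"
      by (simp add: \<kappa>(2))
    also have "\<dots> = \<epsilon> * n0"
      using \<kappa>(1) by simp
    finally show ?thesis .
  qed
  then show ?thesis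
    using c3_pos[OF \<rho> \<tau>] unfolding x_def n0_def \<kappa>_def \<rho>_def by blast
qed

end
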